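(* Consider the CHSH Bell-test configuration with inputs $X,Y\in\{0,1\}$ and outputs $A,B\in\{0,1\}$. Suppose that the trial model $\mathcal{C}$ consists of all non-signaling distributions of $ABXY$ with a fixed input distribution $\mathbb{P}(XY)$ where $\mathbb{P}(xy)>0$ for all $xy$. Let $\nu\in\mathcal{C}$ with $\hat I=\mathbb{E}_\nu(I_{\mathrm{CHSH}})>2$. Then both the maximum asymptotic randomness rate $g_0$ witnessed by probability estimation factors (PEFs) and the single-trial conditional min-entropy $H_{\min}(AB|XYE)$ at $\nu$ depend only on $\hat I$, and are given by $$g_0=\frac{\hat I-2}{2},\qquad H_{\min}(AB|XYE)=-\log_2\!\left(\frac{6-\hat I}{4}\right).$$
   Context: A distribution $\sigma$ of $ABXY$ with input distribution $\sigma(XY)=\mathbb{P}(XY)$ is non-signaling if $\sum_b\sigma(ab|xy)$ does not depend on $y$ for all $a,x$ and $\sum_a\sigma(ab|xy)$ does not depend on $x$ for all $b,y$. The CHSH Bell function is $I_{\mathrm{CHSH}}(ABXY)=(1-2XY)(-1)^{A+B}/\mathbb{P}(XY)$. Write $C=AB$ and $Z=XY$. For $\beta>0$, a PEF with power $\beta$ for $\mathcal{C}$ is a function $F:cz\mapsto F(cz)\ge0$ with $\sum_{cz}F(cz)\sigma(c|z)^\beta\sigma(cz)\le 1$ for all $\sigma\in\mathcal{C}$. For the given $\nu$, $g(\beta)=\sup_F\mathbb{E}_\nu\big(\log_2(F(CZ))/\beta\big)$, where the supremum is over PEFs $F$ with power $\beta$ for $\mathcal{C}$, and the maximum asymptotic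 randomness rate witnessed by PEFs is $g_0=\sup_{\beta>0}g(\beta)$. The single-trial conditional min-entropy at $\nu$ is $H_{\min}(AB|XYE)=-\log_2 P_{\mathrm{guess}}(AB|XYE)$, where the (worst-case, average) guessing probability is $$P_{\mathrm{guess}}(AB|XYE)=\max_{\omega_e,\sigma_e}\Big\{\sum_e\omega_e\sum_{xy}\mathbb{P}(xy)\max_{ab}\sigma_e(ab|xy)\Big\},$$ the maximum being over all countable families with $\sigma_e\in\mathcal{C}$, $\omega_e\ge0$, $\sum_e\omega_e=1$, $\sum_e\omega_e\sigma_e=\nu$. *)

theory Defs
  imports "HOL-Probability.Probability"
begin

text \<open>
  Bits are represented by \<^typ>\<open>bool\<close>, with value \<^const>\<open>of_bool\<close>. A distribution of
  outputs \<open>C\<close> and inputs \<open>Z\<close> is a \<^type>\<open>pmf\<close> on pairs \<open>(c, z)\<close>; for the Bell test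
  \<open>c = (a, b)\<close> and \<open>z = (x, y)\<close>.
\<close>

type_synonym bits2 = "bool \<times> bool"

definition input_dist :: "('c \<times> 'z) pmf \<Rightarrow> 'z pmf" where
  "input_dist \<sigma> = map_pmf snd \<sigma>"

text \<open>The conditional probability \<open>\<sigma>(c|z)\<close>; it is \<open>0\<close> if \<open>\<sigma>(z) = 0\<close>.\<close>

definition cond_prob :: "('c \<times> 'z) pmf \<Rightarrow> 'c \<Rightarrow> 'z \<Rightarrow> real" where
  "cond_prob \<sigma> c z = pmf \<sigma> (c, z) / pmf (input_dist \<sigma>) z"

definition non_signaling :: "(bits2 \<times> bits2) pmf \<Rightarrow> bool" where
  "non_signaling \<sigma> \<longleftrightarrow>
     (\<forall>a x y y'. (\<Sum>b\<in>UNIV. cond_prob \<sigma> (a, b) (x, y)) = (\<Sum>b\<in>UNIV. cond_prob \<sigma> (a, b) (x, y'))) \<and>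
     (\<forall>b y x x'. (\<Sum>a\<in>UNIV. cond_prob \<sigma> (a, b) (x, y)) = (\<Sum>a\<in>UNIV. cond_prob \<sigma> (a, b) (x', y)))"

definition ns_model :: "bits2 pmf \<Rightarrow> (bits2 \<times> bits2) pmf set" where
  "ns_model P = {\<sigma>. input_dist \<sigma> = P \<and> non_signaling \<sigma>}"

fun I_CHSH :: "bits2 pmf \<Rightarrow> bits2 \<times> bits2 \<Rightarrow> real" where
  "I_CHSH P ((a, b), (x, y)) =
     (1 - 2 * of_bool x * of_bool y) * (-1) ^ (of_bool a + of_bool b) / pmf P (x, y)"

definition is_PEF ::
  "real \<Rightarrow> ('c::finite \<times> 'z::finite) pmf set \<Rightarrow> ('c \<times> 'z \<Rightarrow> real) \<Rightarrow> bool" where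
  "is_PEF \<beta> \<C> F \<longleftrightarrow> \<beta> > 0 \<and> (\<forall>cz. F cz \<ge> 0) \<and>
     (\<forall>\<sigma>\<in>\<C>. (\<Sum>(c, z)\<in>UNIV. F (c, z) * cond_prob \<sigma> c z powr \<beta> * pmf \<sigma> (c, z)) \<le> 1)"

text \<open>
  A PEF may vanish, in which case its logarithm is \<open>-\<infinity>\<close>, whereas \<^term>\<open>log 2 0 = (0::real)\<close>.
  Expected values of logarithms are therefore taken in \<^typ>\<open>ereal\<close>, where \<open>0 * (-\<infinity>) = 0\<close>, so
  points of probability \<open>0\<close> do not contribute.
\<close>

definition elog2 :: "real \<Rightarrow> ereal" where
  "elog2 x = (if x = 0 then -\<infinity> else ereal (log 2 x))"

definition PEF_log_rate ::
  "('c::finite \<times> 'z::finite) pmf \<Rightarrow> real \<Rightarrow> ('c \<times> 'z \<Rightarrow> real) \<Rightarrow> ereal" where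
  "PEF_log_rate \<nu> \<beta> F = (\<Sum>cz\<in>UNIV. ereal (pmf \<nu> cz) * (elog2 (F cz) / ereal \<beta>))"

definition PEF_rate ::
  "('c::finite \<times> 'z::finite) pmf set \<Rightarrow> ('c \<times> 'z) pmf \<Rightarrow> real \<Rightarrow> ereal" where
  "PEF_rate \<C> \<nu> \<beta> = (SUP F\<in>{F. is_PEF \<beta> \<C> F}. PEF_log_rate \<nu> \<beta> F)"

definition max_PEF_rate ::
  "('c::finite \<times> 'z::finite) pmf set \<Rightarrow> ('c \<times> 'z) pmf \<Rightarrow> ereal" where
  "max_PEF_rate \<C> \<nu> = (SUP \<beta>\<in>{0<..}. PEF_rate \<C> \<nu> \<beta>)"

text \<open>
  Countable families are indexed by \<^typ>\<open>nat\<close>. Finite families are included, since weights may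
  be \<open>0\<close> and a decomposition of \<open>\<nu>\<close> always provides some member of \<open>\<C>\<close> to pad with.
\<close>

definition decomposition ::
  "('c \<times> 'z) pmf set \<Rightarrow> ('c \<times> 'z) pmf \<Rightarrow> (nat \<Rightarrow> real) \<Rightarrow> (nat \<Rightarrow> ('c \<times> 'z) pmf) \<Rightarrow> bool" where
  "decomposition \<C> \<nu> \<omega> \<sigma> \<longleftrightarrow>
     (\<forall>e. \<sigma> e \<in> \<C>) \<and> (\<forall>e. \<omega> e \<ge> 0) \<and> \<omega> sums 1 \<and>
     (\<forall>cz. (\<lambda>e. \<omega> e * pmf (\<sigma> e) cz) sums pmf \<nu> cz)"

definition guess_value ::
  "'z pmf \<Rightarrow> (nat \<Rightarrow> real) \<Rightarrow> (nat \<Rightarrow> ('c::finite \<times> 'z::finite) pmf) \<Rightarrow> real" where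
  "guess_value P \<omega> \<sigma> =
     (\<Sum>e. \<omega> e * (\<Sum>z\<in>UNIV. pmf P z * (MAX c. cond_prob (\<sigma> e) c z)))"

text \<open>
  \<^const>\<open>Greatest\<close> is the maximum rather than the supremum: its value is only determined
  if the maximum is attained.
\<close>

definition P_guess ::
  "('c::finite \<times> 'z::finite) pmf set \<Rightarrow> 'z pmf \<Rightarrow> ('c \<times> 'z) pmf \<Rightarrow> real" where
  "P_guess \<C> P \<nu> = (GREATEST p. \<exists>\<omega> \<sigma>. decomposition \<C> \<nu> \<omega> \<sigma> \<and> p = guess_value P \<omega> \<sigma>)"

definition H_min ::
  "('c::finite \<times> 'z::finite) pmf set \<Rightarrow> 'z pmf \<Rightarrow> ('c \<times> 'z) pmf \<Rightarrow> real" where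
  "H_min \<C> P \<nu> = - log 2 (P_guess \<C> P \<nu>)"

end

theory Submission
  imports Defs "HOL-Real_Asymp.Real_Asymp"
begin

text \<open>
  Every non-signaling \<open>\<sigma>\<close> with CHSH value \<open>I \<ge> 2\<close> is a mixture of the PR box, with weight
  \<open>(I - 2) / 2\<close>, and of the eight deterministic local boxes with CHSH value 2. The defining
  inequality of a PEF \<open>F\<close> bounds the mean of \<open>F\<close> by \<open>2\<^sup>\<beta>\<close> on the PR box and by 1 on the local boxes,
  so by Jensen's inequality its log-rate is at most the weight of the PR box. Conversely
  \<open>F = 1 + (2\<^sup>\<beta> - 1) (I\<^sub>C\<^sub>H\<^sub>S\<^sub>H - 2) / 2\<close> is a PEF for small \<open>\<beta>\<close>, and its log-rate tends to the same value
  as \<open>\<beta>\<close> tends to 0. A local box is guessed with certainty and the PR box with probability 1/2, so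
  the mixture above gives guessing probability \<open>1 - (I - 2) / 4\<close>; this is optimal because
  \<open>\<sigma>(c|z) \<le> (6 - I) / 4\<close> holds pointwise and is affine in \<open>\<sigma>\<close>.
\<close>

section \<open>Joint distributions from an input distribution and conditionals\<close>

definition with_input :: "'z pmf \<Rightarrow> ('z \<Rightarrow> 'c pmf) \<Rightarrow> ('c \<times> 'z) pmf" where
  "with_input P K = bind_pmf P (\<lambda>z. map_pmf (\<lambda>c. (c, z)) (K z))"

lemma input_dist_with_input [simp]: "input_dist (with_input P K) = P"
  by (simp add: input_dist_def with_input_def map_bind_pmf map_pmf_comp bind_return_pmf')

lemma pmf_with_input: "pmf (with_input P K) (c, z) = pmf P z * pmf (K z) c"
proof -
  have "pmf (map_pmf (\<lambda>c. (c, z')) (K z')) (c, z) = indicator {z} z' * pmf (K z) c" for z'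
  proof (cases "z' = z")
    case True
    then show ?thesis
      by (simp add: pmf_map_inj'[where f = "\<lambda>c. (c, z)"] inj_on_def)
  next
    case False
    then show ?thesis
      by (auto intro!: pmf_map_outside)
  qed
  then have "pmf (with_input P K) (c, z) = (\<integral>z'. indicator {z} z' * pmf (K z) c \<partial>measure_pmf P)"
    by (simp add: with_input_def pmf_bind)
  then show ?thesis
    by (simp add: measure_pmf_single)
qed

lemma cond_prob_with_input: "pmf P z > 0 \<Longrightarrow> cond_prob (with_input P K) c z = pmf (K z) c"
  by (simp add: cond_prob_def pmf_with_input)

lemma cond_prob_nonneg: "cond_prob \<sigma> c z \<ge> 0"
  by (simp add: cond_prob_def)

lemma sum_cond_prob:
  fixes \<sigma> :: "('c::finite \<times> 'z) pmf"
  assumes "pmf (input_dist \<sigma>) z > 0"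
  shows "(\<Sum>c\<in>UNIV. cond_prob \<sigma> c z) = 1"
proof -
  have "pmf (input_dist \<sigma>) z = measure \<sigma> (snd -` {z})"
    by (simp add: input_dist_def pmf_map)
  also have "snd -` {z} = (\<lambda>c. (c, z)) ` (UNIV :: 'c set)"
    by auto
  also have "measure \<sigma> ((\<lambda>c. (c, z)) ` (UNIV :: 'c set)) = (\<Sum>c\<in>UNIV. pmf \<sigma> (c, z))"
    by (simp add: measure_measure_pmf_finite sum.reindex inj_on_def)
  finally show ?thesis
    using assms by (simp add: cond_prob_def flip: sum_divide_distrib)
qed

lemma cond_prob_le_1:
  fixes \<sigma> :: "('c::finite \<times> 'z) pmf"
  assumes "pmf (input_dist \<sigma>) z > 0"
  shows "cond_prob \<sigma> c z \<le> 1"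
  using member_le_sum[of c UNIV "\<lambda>c. cond_prob \<sigma> c z"]
  by (simp add: cond_prob_nonneg sum_cond_prob[OF assms])

text \<open>The endpoint 0 has to be included because boxes assign probability 0 to some outcomes.
  When \<open>x\<close> or \<open>y\<close> is 0, the claim reduces to
  \<open>s powr p \<le> s\<close> for \<open>0 < s < 1\<close>.\<close>

lemma powr_convex_nonneg:
  assumes "p \<ge> 1"
  shows "convex_on {0..} (\<lambda>x. x powr p :: real)"
proof (rule convex_onI)
  fix t x y :: real
  assume t: "0 < t" "t < 1" and xy: "x \<in> {0..}" "y \<in> {0..}"
  have scale: "(s * u) powr p \<le> s * u powr p" if "0 < s" "s < 1" "0 \<le> u" for s u :: real
    using that assms powr_mono'[of 1 p s] by (auto simp: powr_mult intro!: mult_right_mono)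
  show "((1 - t) *\<^sub>R x + t *\<^sub>R y) powr p \<le> (1 - t) * x powr p + t * y powr p"
  proof (cases "x = 0 \<or> y = 0")
    case True
    then show ?thesis
      using scale[of t y] scale[of "1 - t" x] t xy assms by auto
  next
    case False
    then show ?thesis
      using convex_onD[OF powr_convex[OF assms], of t x y] t xy by auto
  qed
qed simp

text \<open>Turns a finite mixture into a zero-padded series, the form that
  \<open>decomposition\<close> asks for.\<close>

lemma sums_bij_betw_finite:
  fixes f :: "'a::finite \<Rightarrow> real"
  assumes "bij_betw h {..<n} UNIV"
  shows "(\<lambda>e. if e < n then f (h e) else 0) sums (\<Sum>i\<in>UNIV. f i)"
proof -
  have "(\<lambda>e. if e \<in> {..<n} then f (h e) else 0) sums (\<Sum>e\<in>{..<n}. f (h e))"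
    by (rule sums_If_finite_set) simp
  then show ?thesis
    by (simp add: sum.reindex_bij_betw[OF assms])
qed

section \<open>The CHSH value and the nine boxes\<close>

lemma sum_bits2: "(\<Sum>z\<in>UNIV. f z) = (\<Sum>x\<in>UNIV. \<Sum>y\<in>UNIV. f (x, y))"
  for f :: "bits2 \<Rightarrow> real"
  by (simp add: sum.cartesian_product)

text \<open>The mean of \<open>I_CHSH\<close> with the input probabilities cancelled, hence linear
  in the conditional probabilities alone. At each input pair it adds the probability of winning
  minus that of losing.\<close>

definition chsh :: "(bits2 \<times> bits2) pmf \<Rightarrow> real" where
  "chsh \<sigma> = (\<Sum>(x, y)\<in>UNIV. \<Sum>(a, b)\<in>UNIV.
     (1 - 2 * of_bool x * of_bool y) * (-1) ^ (of_bool a + of_bool b) * cond_prob \<sigma> (a, b) (x, y))"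

text \<open>
  The PR box \<open>None\<close> outputs uniform bits with \<open>a \<oplus> b = x \<and> y\<close>. The box \<open>Some (a, x', y')\<close> is
  deterministic, answers \<open>a\<close> and the losing \<open>b\<close> on the inputs \<open>(x', y')\<close>, and wins on the other
  three inputs. The nine boxes are the vertices of the part of the non-signaling polytope with
  CHSH value at least 2.
\<close>

fun ns_vertex :: "(bool \<times> bool \<times> bool) option \<Rightarrow> bits2 \<Rightarrow> bits2 pmf" where
  "ns_vertex None (x, y) = map_pmf (\<lambda>a. (a, a \<noteq> (x \<and> y))) (pmf_of_set UNIV)"
| "ns_vertex (Some (a, x', y')) (x, y) =
     (let b = (a = (x' \<and> y'))
      in return_pmf (if x = x' then a else b \<noteq> (\<not> x' \<and> y'),
                     if y = y' then b else a \<noteq> (x' \<and> \<not> y')))"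

text \<open>Each box is flat: given an input, all its possible outputs are equally likely, and this
  is their common probability. It is therefore also the probability of guessing the output.\<close>

fun vertex_peak :: "(bool \<times> bool \<times> bool) option \<Rightarrow> real" where
  "vertex_peak None = 1 / 2"
| "vertex_peak (Some _) = 1"

lemma vertex_peak_pos: "vertex_peak i > 0"
  by (cases i) auto

lemma pmf_ns_vertex_None:
  "pmf (ns_vertex None (x, y)) (a, b) = (if (a \<noteq> b) = (x \<and> y) then 1/2 else 0)"
proof -
  have "(\<lambda>a. (a, a \<noteq> (x \<and> y))) -` {(a, b)} = (if (a \<noteq> b) = (x \<and> y) then {a} else {})"
    by auto
  then show ?thesis
    by (simp add: pmf_map measure_pmf_single del: not_iff)
qed

lemma pmf_ns_vertex: "pmf (ns_vertex i z) c = 0 \<or> pmf (ns_vertex i z) c = vertex_peak i"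
proof (cases i)
  case None
  then show ?thesis
    by (cases z; cases c) (simp add: pmf_ns_vertex_None del: ns_vertex.simps)
next
  case (Some l)
  then show ?thesis
    by (cases l; cases z; cases c) (auto simp: Let_def indicator_def)
qed

lemma Max_pmf_ns_vertex: "(MAX c. pmf (ns_vertex i z) c) = vertex_peak i"
proof (rule Max_eqI)
  obtain c where "c \<in> set_pmf (ns_vertex i z)"
    using set_pmf_not_empty by fast
  then show "vertex_peak i \<in> range (pmf (ns_vertex i z))"
    using pmf_ns_vertex[of i z c] by (metis rangeI set_pmf_iff)
qed (use pmf_ns_vertex[of i z] vertex_peak_pos[of i] in \<open>auto, metis less_eq_real_def\<close>)

text \<open>
  Among the nine boxes only \<open>Some (a, x, y)\<close> can produce the losing answer \<open>(a, a = (x \<and> y))\<close> on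
  \<open>(x, y)\<close>, so its weight must be the probability of that answer. For CHSH value below 2 the weight
  of the PR box is negative.
\<close>

fun weight :: "(bits2 \<times> bits2) pmf \<Rightarrow> (bool \<times> bool \<times> bool) option \<Rightarrow> real" where
  "weight \<sigma> None = (chsh \<sigma> - 2) / 2"
| "weight \<sigma> (Some (a, x, y)) = cond_prob \<sigma> (a, a = (x \<and> y)) (x, y)"

lemma weight_Some_nonneg: "weight \<sigma> (Some l) \<ge> 0"
  by (cases l) (simp add: cond_prob_nonneg)

lemma weight_nonneg: "chsh \<sigma> \<ge> 2 \<Longrightarrow> weight \<sigma> i \<ge> 0"
  by (cases i) (auto simp: weight_Some_nonneg)

lemma UNIV_option_bits: "(UNIV :: (bool \<times> bool \<times> bool) option set) =
    {None, Some (False, False, False), Some (False, False, True), Some (False, True, False),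
     Some (False, True, True), Some (True, False, False), Some (True, False, True),
     Some (True, True, False), Some (True, True, True)}"
  by (auto simp: UNIV_option_conv)

definition ns_box :: "bits2 pmf \<Rightarrow> (bool \<times> bool \<times> bool) option \<Rightarrow> (bits2 \<times> bits2) pmf" where
  "ns_box P i = with_input P (ns_vertex i)"

section \<open>Decomposition of non-signaling distributions into boxes\<close>

context
  fixes P :: "bits2 pmf"
  assumes P_pos: "\<And>x y. pmf P (x, y) > 0"
begin

lemma input_pos: "pmf P z > 0"
  using P_pos by (cases z) auto

lemma input_dist_ns_model: "\<sigma> \<in> ns_model P \<Longrightarrow> input_dist \<sigma> = P"
  by (simp add: ns_model_def)

lemma pmf_eq_cond_prob:
  assumes "\<sigma> \<in> ns_model P"
  shows "pmf \<sigma> (c, z) = pmf P z * cond_prob \<sigma> c z"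
  using input_pos[of z] by (simp add: cond_prob_def input_dist_ns_model[OF assms])

lemma sum_pmf_I_CHSH:
  assumes "\<sigma> \<in> ns_model P"
  shows "(\<Sum>cz\<in>UNIV. pmf \<sigma> cz * I_CHSH P cz) = chsh \<sigma>"
proof -
  have "(\<Sum>cz\<in>UNIV. pmf \<sigma> cz * I_CHSH P cz) =
      (\<Sum>c\<in>UNIV. \<Sum>z\<in>UNIV. pmf \<sigma> (c, z) * I_CHSH P (c, z))"
    by (simp add: sum.cartesian_product)
  also have "\<dots> = (\<Sum>z\<in>UNIV. \<Sum>c\<in>UNIV. pmf \<sigma> (c, z) * I_CHSH P (c, z))"
    by (rule sum.swap)
  also have "\<dots> = chsh \<sigma>"
    unfolding chsh_def
    by (intro sum.cong refl) (auto simp: cond_prob_def input_dist_ns_model[OF assms] intro!: sum.cong)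
  finally show ?thesis .
qed

text \<open>Normalization, oriented as a rewrite rule that eliminates one of the four
  outcomes.\<close>

lemma cond_prob_True_True:
  assumes "\<sigma> \<in> ns_model P"
  shows "cond_prob \<sigma> (True, True) (x, y) = 1 - cond_prob \<sigma> (True, False) (x, y) -
    cond_prob \<sigma> (False, True) (x, y) - cond_prob \<sigma> (False, False) (x, y)"
  using sum_cond_prob[of \<sigma> "(x, y)"] P_pos
  by (simp add: input_dist_ns_model[OF assms] sum_bits2 UNIV_bool)

lemma marginal_eq:
  assumes "\<sigma> \<in> ns_model P"
  shows "cond_prob \<sigma> (a, True) (x, y) + cond_prob \<sigma> (a, False) (x, y) =
      cond_prob \<sigma> (a, True) (x, y') + cond_prob \<sigma> (a, False) (x, y')"
    and "cond_prob \<sigma> (True, b) (x, y) + cond_prob \<sigma> (False, b) (x, y) =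
      cond_prob \<sigma> (True, b) (x', y) + cond_prob \<sigma> (False, b) (x', y)"
  using assms unfolding ns_model_def non_signaling_def by (simp_all add: UNIV_bool add.commute)

text \<open>If \<open>L\<close> is the sum of the four losing probabilities, the CHSH value is
  \<open>4 - 2 * L\<close>. The PR box thus has weight \<open>1 - L\<close>, while the local boxes
  share \<open>L\<close>.\<close>

lemma sum_weight:
  assumes "\<sigma> \<in> ns_model P"
  shows "(\<Sum>i\<in>UNIV. weight \<sigma> i) = 1"
  by (simp add: UNIV_option_bits chsh_def sum_bits2 UNIV_bool
      cond_prob_True_True[OF assms] field_simps split_def)

text \<open>The nine boxes are affinely independent and the non-signaling conditionals form an
  8-dimensional set, so the weights are barycentric coordinates. The identity is linear and holds
  for every CHSH value; only the signs of the weights depend on it.\<close>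

lemma cond_prob_vertex_sum:
  assumes "\<sigma> \<in> ns_model P"
  shows "cond_prob \<sigma> c z = (\<Sum>i\<in>UNIV. weight \<sigma> i * pmf (ns_vertex i z) c)"
proof -
  obtain a b x y where c: "c = (a, b)" and z: "z = (x, y)"
    by (metis surj_pair)
  note [simp del] = ns_vertex.simps(1)
  show ?thesis
    unfolding c z
    \<comment> \<open>One equation for each party and each input of that party; those for output
      \<open>True\<close> follow by normalization.\<close>
    using marginal_eq(1)[OF assms, of False True True False]
      marginal_eq(1)[OF assms, of False False True False]
      marginal_eq(2)[OF assms, of False True True False]
      marginal_eq(2)[OF assms, of False True False False]
    by (cases a; cases b; cases x; cases y;
        simp add: UNIV_option_bits chsh_def sum_bits2 UNIV_bool cond_prob_True_True[OF assms] field_simps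
          pmf_ns_vertex_None Let_def split_def; linarith)
qed

lemma pmf_ns_box: "pmf (ns_box P i) (c, z) = pmf P z * pmf (ns_vertex i z) c"
  by (simp add: ns_box_def pmf_with_input)

lemma cond_prob_ns_box: "cond_prob (ns_box P i) c z = pmf (ns_vertex i z) c"
  by (simp add: ns_box_def cond_prob_with_input input_pos)

lemma ns_box_in_ns_model: "ns_box P i \<in> ns_model P"
proof -
  have "non_signaling (ns_box P i)"
  proof (cases i)
    case None
    then show ?thesis
      by (simp add: non_signaling_def all_bool_eq cond_prob_ns_box UNIV_bool
          pmf_ns_vertex_None del: ns_vertex.simps)
  next
    case (Some l)
    then obtain a x y where "i = Some (a, x, y)"
      by (metis prod_cases3)
    then show ?thesis
      by (cases a; cases x; cases y)
        (simp_all add: non_signaling_def all_bool_eq cond_prob_ns_box UNIV_bool Let_def indicator_def)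
  qed
  then show ?thesis
    by (simp add: ns_model_def ns_box_def)
qed

lemma chsh_ns_box: "chsh (ns_box P i) = (if i = None then 4 else 2)"
proof (cases i)
  case None
  then show ?thesis
    by (simp add: chsh_def sum_bits2 cond_prob_ns_box UNIV_bool pmf_ns_vertex_None del: ns_vertex.simps)
next
  case (Some l)
  then obtain a x y where "i = Some (a, x, y)"
    by (metis prod_cases3)
  then show ?thesis
    by (cases a; cases x; cases y)
      (simp_all add: chsh_def sum_bits2 cond_prob_ns_box UNIV_bool Let_def indicator_def)
qed

lemma pmf_box_sum:
  assumes "\<sigma> \<in> ns_model P"
  shows "pmf \<sigma> cz = (\<Sum>i\<in>UNIV. weight \<sigma> i * pmf (ns_box P i) cz)"
proof -
  obtain c z where "cz = (c, z)"
    by (rule prod.exhaust)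
  then show ?thesis
    using cond_prob_vertex_sum[OF assms]
    by (simp add: pmf_eq_cond_prob[OF assms] pmf_ns_box
        sum_distrib_left mult_ac)
qed

lemma sum_weight_Some:
  assumes "\<sigma> \<in> ns_model P"
  shows "(\<Sum>l\<in>UNIV. weight \<sigma> (Some l)) = (4 - chsh \<sigma>) / 2"
  using sum_weight[OF assms] by (simp add: UNIV_option_conv sum.reindex field_simps)

lemma sum_weight_vertex_peak:
  assumes "\<sigma> \<in> ns_model P"
  shows "(\<Sum>i\<in>UNIV. weight \<sigma> i * vertex_peak i) = (6 - chsh \<sigma>) / 4"
  using sum_weight_Some[OF assms] by (simp add: UNIV_option_conv sum.reindex field_simps)

section \<open>Upper bound on the log-rate of a PEF\<close>

lemma PEF_sum_ns_box:
  assumes "is_PEF \<beta> (ns_model P) F"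
  shows "(\<Sum>cz\<in>UNIV. F cz * vertex_peak i powr \<beta> * pmf (ns_box P i) cz) \<le> 1"
proof -
  \<comment> \<open>Off the support of the box both sides vanish; on it the conditional probability
    is the peak.\<close>
  have eq: "F (c, z) * cond_prob (ns_box P i) c z powr \<beta> * pmf (ns_box P i) (c, z) =
      F (c, z) * vertex_peak i powr \<beta> * pmf (ns_box P i) (c, z)" for c z
    using pmf_ns_vertex[of i z c] by (auto simp: cond_prob_ns_box pmf_ns_box)
  have "(\<Sum>cz\<in>UNIV. F cz * vertex_peak i powr \<beta> * pmf (ns_box P i) cz) =
      (\<Sum>(c, z)\<in>UNIV. F (c, z) * cond_prob (ns_box P i) c z powr \<beta> * pmf (ns_box P i) (c, z))"
    unfolding split_beta eq unfolding prod.collapse ..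
  also have "\<dots> \<le> 1"
    using assms ns_box_in_ns_model[of i] unfolding is_PEF_def by blast
  finally show ?thesis .
qed

text \<open>The bound is \<open>\<beta> * ln 2\<close> for the PR box and 0 for a local box. The
  condition \<open>supp\<close> keeps the default value \<open>ln 0 = 0\<close> from entering the
  mean.\<close>

lemma sum_ns_box_ln_PEF_le:
  assumes F: "is_PEF \<beta> (ns_model P) F"
    and supp: "\<And>cz. pmf (ns_box P i) cz > 0 \<Longrightarrow> F cz > 0"
  shows "(\<Sum>cz\<in>UNIV. pmf (ns_box P i) cz * ln (F cz)) \<le> - \<beta> * ln (vertex_peak i)"
proof -
  let ?p = "pmf (ns_box P i)" and ?v = "vertex_peak i"
  \<comment> \<open>Jensen's inequality in the form \<open>ln t \<le> t - 1\<close> for \<open>t = F cz * ?v powr \<beta>\<close>, whose mean is at most 1\<close>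
  have "?p cz * ln (F cz) \<le> F cz * ?v powr \<beta> * ?p cz - ?p cz - \<beta> * ln ?v * ?p cz" for cz
  proof (cases "?p cz = 0")
    case False
    then have "?p cz > 0"
      by (simp add: order_less_le)
    then have "F cz > 0"
      by (rule supp)
    moreover have "?v powr \<beta> > 0"
      using vertex_peak_pos[of i] by simp
    ultimately have "ln (F cz) + \<beta> * ln ?v \<le> F cz * ?v powr \<beta> - 1"
      using ln_le_minus_one[of "F cz * ?v powr \<beta>"] vertex_peak_pos[of i]
      by (simp add: ln_mult_pos ln_powr)
    with \<open>?p cz > 0\<close> have "?p cz * (ln (F cz) + \<beta> * ln ?v) \<le> ?p cz * (F cz * ?v powr \<beta> - 1)"
      by (intro mult_left_mono) auto
    then show ?thesis
      by (simp add: algebra_simps)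
  qed simp
  then have "(\<Sum>cz\<in>UNIV. ?p cz * ln (F cz)) \<le>
      (\<Sum>cz\<in>UNIV. F cz * ?v powr \<beta> * ?p cz - ?p cz - \<beta> * ln ?v * ?p cz)"
    by (intro sum_mono)
  also have "\<dots> = (\<Sum>cz\<in>UNIV. F cz * ?v powr \<beta> * ?p cz) - 1 - \<beta> * ln ?v"
    by (simp add: sum_subtractf sum_pmf_eq_1 flip: sum_distrib_left)
  finally show ?thesis
    using PEF_sum_ns_box[OF F, of i] by simp
qed

lemma PEF_log_rate_le:
  assumes F: "is_PEF \<beta> (ns_model P) F" and \<nu>: "\<nu> \<in> ns_model P" and ge: "chsh \<nu> \<ge> 2"
  shows "PEF_log_rate \<nu> \<beta> F \<le> ereal ((chsh \<nu> - 2) / 2)"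
proof (cases "\<exists>cz. pmf \<nu> cz > 0 \<and> F cz = 0")
  case True
  then obtain cz where cz: "pmf \<nu> cz > 0" "F cz = 0"
    by blast
  let ?g = "\<lambda>cz. ereal (pmf \<nu> cz) * (elog2 (F cz) / ereal \<beta>)"
  have "\<beta> > 0"
    using F by (simp add: is_PEF_def)
  then have "?g cz = -\<infinity>"
    using cz by (simp add: elog2_def)
  \<comment> \<open>With no term equal to \<open>\<infinity>\<close>, the single term
    \<open>-\<infinity>\<close> decides the sum.\<close>
  moreover have "?g cz' < \<infinity>" for cz'
    using \<open>\<beta> > 0\<close> by (cases "pmf \<nu> cz' = 0") (auto simp: elog2_def order_less_le)
  then have "sum ?g (UNIV - {cz}) \<noteq> \<infinity>"
    unfolding sum_Pinfty by (metis less_irrefl)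
  ultimately have "sum ?g UNIV = -\<infinity>"
    by (subst sum.remove[of UNIV cz]) auto
  then show ?thesis
    by (simp add: PEF_log_rate_def)
next
  case False
  then have F_ne: "F cz \<noteq> 0" if "pmf \<nu> cz > 0" for cz
    using that by blast
  have \<beta>: "\<beta> > 0" and F0: "F cz \<ge> 0" for cz
    using F unfolding is_PEF_def by blast+
  have "(\<Sum>cz\<in>UNIV. pmf (ns_box P i) cz * ln (F cz)) * weight \<nu> i
      \<le> - \<beta> * ln (vertex_peak i) * weight \<nu> i" for i
  proof (cases "weight \<nu> i = 0")
    case False
    then have w: "weight \<nu> i > 0"
      using weight_nonneg[OF ge, of i] by simp
    \<comment> \<open>A box of positive weight has its support inside that of \<open>\<nu>\<close>,
      where \<open>F\<close> does not vanish.\<close>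
    have "F cz > 0" if "pmf (ns_box P i) cz > 0" for cz
    proof -
      have "0 < weight \<nu> i * pmf (ns_box P i) cz"
        using that w by simp
      also have "\<dots> \<le> pmf \<nu> cz"
        unfolding pmf_box_sum[OF \<nu>] using weight_nonneg[OF ge] by (intro member_le_sum) auto
      finally show ?thesis
        using F0[of cz] F_ne[of cz] by (simp add: order_less_le)
    qed
    then show ?thesis
      using w by (intro mult_right_mono sum_ns_box_ln_PEF_le[OF F]) auto
  qed simp
  then have "(\<Sum>i\<in>UNIV. (\<Sum>cz\<in>UNIV. pmf (ns_box P i) cz * ln (F cz)) * weight \<nu> i) \<le>
      (\<Sum>i\<in>UNIV. - \<beta> * ln (vertex_peak i) * weight \<nu> i)"
    by (intro sum_mono)
  \<comment> \<open>Local boxes drop out since their peak is 1.\<close>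
  also have "\<dots> = \<beta> * ln 2 * ((chsh \<nu> - 2) / 2)"
    by (simp add: UNIV_option_conv sum.reindex ln_div)
  also have "(\<Sum>i\<in>UNIV. (\<Sum>cz\<in>UNIV. pmf (ns_box P i) cz * ln (F cz)) * weight \<nu> i) =
      (\<Sum>cz\<in>UNIV. pmf \<nu> cz * ln (F cz))"
    unfolding pmf_box_sum[OF \<nu>] sum_distrib_right
    by (subst sum.swap) (simp add: mult_ac)
  finally have "(\<Sum>cz\<in>UNIV. pmf \<nu> cz * ln (F cz)) / (\<beta> * ln 2) \<le> (chsh \<nu> - 2) / 2"
    using \<beta> by (simp add: pos_divide_le_eq mult_ac)
  moreover have "ereal (pmf \<nu> cz) * (elog2 (F cz) / ereal \<beta>) =
      ereal (pmf \<nu> cz * ln (F cz) / (\<beta> * ln 2))" for cz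
    using F_ne[of cz] \<beta> by (cases "pmf \<nu> cz = 0") (auto simp: elog2_def log_def order_less_le mult.commute)
  then have "PEF_log_rate \<nu> \<beta> F = ereal ((\<Sum>cz\<in>UNIV. pmf \<nu> cz * ln (F cz)) / (\<beta> * ln 2))"
    by (simp add: PEF_log_rate_def sum_divide_distrib)
  ultimately show ?thesis
    by simp
qed

section \<open>A PEF built from the CHSH function\<close>

lemma sum_pmf_chsh_gain:
  assumes "\<sigma> \<in> ns_model P"
  shows "(\<Sum>cz\<in>UNIV. pmf \<sigma> cz * ((I_CHSH P cz - 2) / 2)) = (chsh \<sigma> - 2) / 2"
  using sum_pmf_I_CHSH[OF assms]
  by (simp add: right_diff_distrib diff_divide_distrib sum_subtractf sum_pmf_eq_1
      flip: sum_divide_distrib sum_distrib_right)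

text \<open>The mean is affine in the CHSH value: 1 on a local box and \<open>1 + d\<close> on the
  PR box.\<close>

lemma sum_chsh_factor:
  assumes "\<sigma> \<in> ns_model P"
  shows "(\<Sum>cz\<in>UNIV. (1 + d * ((I_CHSH P cz - 2) / 2)) * pmf \<sigma> cz) = 1 + d * ((chsh \<sigma> - 2) / 2)"
proof -
  have "(\<Sum>cz\<in>UNIV. (1 + d * ((I_CHSH P cz - 2) / 2)) * pmf \<sigma> cz) =
    (\<Sum>cz\<in>UNIV. pmf \<sigma> cz) + d * (\<Sum>cz\<in>UNIV. pmf \<sigma> cz * ((I_CHSH P cz - 2) / 2))"
    by (simp add: sum_distrib_left algebra_simps flip: sum.distrib)
  then show ?thesis
    unfolding sum_pmf_chsh_gain[OF assms] by (simp add: sum_pmf_eq_1)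
qed

text \<open>
  If the CHSH value is at most 2, dropping the factor \<open>\<sigma>(c|z)\<^sup>\<beta> \<le> 1\<close> suffices. Otherwise convexity of
  \<open>t \<mapsto> t\<^sup>1\<^sup>+\<^sup>\<beta>\<close> reduces the claim to the nine boxes, for each of which it holds with equality.
\<close>

lemma is_PEF_chsh:
  assumes \<beta>: "\<beta> > 0"
    and nonneg: "\<And>cz. 1 + (2 powr \<beta> - 1) * ((I_CHSH P cz - 2) / 2) \<ge> 0"
  shows "is_PEF \<beta> (ns_model P) (\<lambda>cz. 1 + (2 powr \<beta> - 1) * ((I_CHSH P cz - 2) / 2))"
proof -
  define F where "F = (\<lambda>cz. 1 + (2 powr \<beta> - 1) * ((I_CHSH P cz - 2) / 2))"
  have F: "F cz \<ge> 0" for cz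
    using nonneg by (simp add: F_def)
  have d: "2 powr \<beta> - 1 \<ge> 0"
    using \<beta> by (simp add: ge_one_powr_ge_zero)
  have sum_F: "(\<Sum>cz\<in>UNIV. F cz * pmf \<sigma> cz) = 1 + (2 powr \<beta> - 1) * ((chsh \<sigma> - 2) / 2)"
    if "\<sigma> \<in> ns_model P" for \<sigma>
    unfolding F_def by (rule sum_chsh_factor[OF that])
  have "(\<Sum>(c, z)\<in>UNIV. F (c, z) * cond_prob \<sigma> c z powr \<beta> * pmf \<sigma> (c, z)) \<le> 1"
    if \<sigma>: "\<sigma> \<in> ns_model P" for \<sigma>
  proof (cases "chsh \<sigma> \<ge> 2")
    case False
    have "cond_prob \<sigma> c z powr \<beta> \<le> 1" for c z
      using cond_prob_le_1[of \<sigma> z c] cond_prob_nonneg[of \<sigma> c z] input_pos[of z] \<beta>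
      by (intro powr_le1) (auto simp: input_dist_ns_model[OF \<sigma>])
    then have "F (c, z) * cond_prob \<sigma> c z powr \<beta> * pmf \<sigma> (c, z) \<le> F (c, z) * 1 * pmf \<sigma> (c, z)" for c z
      using F by (intro mult_right_mono mult_left_mono) auto
    then have "(\<Sum>(c, z)\<in>UNIV. F (c, z) * cond_prob \<sigma> c z powr \<beta> * pmf \<sigma> (c, z)) \<le>
        (\<Sum>cz\<in>UNIV. F cz * pmf \<sigma> cz)"
      by (intro sum_mono) auto
    also have "\<dots> \<le> 1"
      using d False by (simp add: sum_F[OF \<sigma>] mult_nonneg_nonpos)
    finally show ?thesis .
  next
    case True
    have "F (c, z) * cond_prob \<sigma> c z powr \<beta> * pmf \<sigma> (c, z) \<le>
        (\<Sum>i\<in>UNIV. weight \<sigma> i * vertex_peak i powr \<beta> * (F (c, z) * pmf (ns_box P i) (c, z)))" for c z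
    proof -
      let ?q = "\<lambda>i. pmf (ns_vertex i z) c"
      \<comment> \<open>The exponent is \<open>\<beta> + 1\<close> because
        \<open>pmf \<sigma> (c, z)\<close> contributes one more factor
        \<open>cond_prob \<sigma> c z\<close>.\<close>
      have "cond_prob \<sigma> c z powr (\<beta> + 1) \<le> (\<Sum>i\<in>UNIV. weight \<sigma> i * ?q i powr (\<beta> + 1))"
        unfolding cond_prob_vertex_sum[OF \<sigma>]
        using convex_on_sum[OF _ _ powr_convex_nonneg[of "\<beta> + 1"] sum_weight[OF \<sigma>], of ?q]
          weight_nonneg[OF True] \<beta> by simp
      then have "F (c, z) * pmf P z * cond_prob \<sigma> c z powr (\<beta> + 1) \<le>
          F (c, z) * pmf P z * (\<Sum>i\<in>UNIV. weight \<sigma> i * ?q i powr (\<beta> + 1))"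
        using F by (intro mult_left_mono) auto
      moreover have "?q i powr (\<beta> + 1) = vertex_peak i powr \<beta> * ?q i" for i
        using pmf_ns_vertex[of i z c] vertex_peak_pos[of i] by (auto simp: powr_add)
      moreover have "cond_prob \<sigma> c z powr (\<beta> + 1) = cond_prob \<sigma> c z powr \<beta> * cond_prob \<sigma> c z"
        using cond_prob_nonneg[of \<sigma> c z] by (cases "cond_prob \<sigma> c z = 0") (auto simp: powr_add)
      ultimately show ?thesis
        by (simp add: pmf_eq_cond_prob[OF \<sigma>]
            pmf_ns_box sum_distrib_left mult_ac)
    qed
    then have "(\<Sum>(c, z)\<in>UNIV. F (c, z) * cond_prob \<sigma> c z powr \<beta> * pmf \<sigma> (c, z)) \<le>
        (\<Sum>cz\<in>UNIV. \<Sum>i\<in>UNIV. weight \<sigma> i * vertex_peak i powr \<beta> * (F cz * pmf (ns_box P i) cz))"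
      by (intro sum_mono) auto
    also have "\<dots> = (\<Sum>i\<in>UNIV. weight \<sigma> i * vertex_peak i powr \<beta> *
        (\<Sum>cz\<in>UNIV. F cz * pmf (ns_box P i) cz))"
      by (subst sum.swap) (simp add: sum_distrib_left)
    also have "\<dots> = (\<Sum>i\<in>UNIV. weight \<sigma> i)"
    proof (intro sum.cong refl)
      fix i
      \<comment> \<open>This fixes the constant \<open>2 powr \<beta> - 1\<close>: on the PR box the
        mean of \<open>F\<close> is \<open>2 powr \<beta>\<close>, which cancels
        \<open>(1/2) powr \<beta>\<close>.\<close>
      have "vertex_peak i powr \<beta> * (\<Sum>cz\<in>UNIV. F cz * pmf (ns_box P i) cz) = 1"
        unfolding sum_F[OF ns_box_in_ns_model] chsh_ns_box
        by (cases i) (auto simp: powr_divide)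
      then show "weight \<sigma> i * vertex_peak i powr \<beta> * (\<Sum>cz\<in>UNIV. F cz * pmf (ns_box P i) cz) = weight \<sigma> i"
        by (simp add: mult.assoc)
    qed
    finally show ?thesis
      by (simp add: sum_weight[OF \<sigma>])
  qed
  then show ?thesis
    using \<beta> F unfolding is_PEF_def F_def by blast
qed

lemma max_PEF_rate_ge:
  assumes \<nu>: "\<nu> \<in> ns_model P"
  shows "ereal ((chsh \<nu> - 2) / 2) \<le> max_PEF_rate (ns_model P) \<nu>"
proof -
  define G where "G cz = (I_CHSH P cz - 2) / 2" for cz
  define F where "F \<beta> cz = 1 + (2 powr \<beta> - 1) * G cz" for \<beta> :: real and cz
  have "((\<lambda>\<beta>. F \<beta> cz) \<longlongrightarrow> 1) (at_right 0)" for cz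
    unfolding F_def by real_asymp
  \<comment> \<open>\<open>G\<close> may be negative, so positivity of \<open>F\<close> is only
    available for small \<open>\<beta>\<close>; finitely many points allow a common bound.\<close>
  then have "eventually (\<lambda>\<beta>. F \<beta> cz > 0) (at_right 0)" for cz
    by (rule order_tendstoD) simp
  then have "eventually (\<lambda>\<beta>. \<forall>cz. F \<beta> cz > 0) (at_right 0)"
    by (intro eventually_all_finite) auto
  moreover have "eventually (\<lambda>\<beta>. \<beta> > 0) (at_right (0::real))"
    by (simp add: eventually_at_right_less)
  ultimately have ev: "eventually (\<lambda>\<beta>. ereal (\<Sum>cz\<in>UNIV. pmf \<nu> cz * (log 2 (F \<beta> cz) / \<beta>))
      \<le> max_PEF_rate (ns_model P) \<nu>) (at_right 0)"
  proof eventually_elim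
    case (elim \<beta>)
    have "is_PEF \<beta> (ns_model P) (F \<beta>)"
      using is_PEF_chsh[OF elim(2)] less_imp_le[OF spec[OF elim(1)]] unfolding F_def G_def by blast
    then have "PEF_log_rate \<nu> \<beta> (F \<beta>) \<le> PEF_rate (ns_model P) \<nu> \<beta>"
      unfolding PEF_rate_def by (intro SUP_upper) simp
    also have "\<dots> \<le> max_PEF_rate (ns_model P) \<nu>"
      unfolding max_PEF_rate_def using elim by (intro SUP_upper) simp
    finally show ?case
      using elim by (simp add: PEF_log_rate_def elog2_def less_imp_neq[symmetric])
  qed
  \<comment> \<open>The limit is the derivative of \<open>log 2 (F \<beta> cz)\<close> at
    \<open>\<beta> = 0\<close>, whose mean under \<open>\<nu>\<close> is the weight of the PR
    box.\<close>
  have "((\<lambda>\<beta>. log 2 (F \<beta> cz) / \<beta>) \<longlongrightarrow> G cz) (at_right 0)" for cz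
    unfolding F_def by real_asymp
  then have "((\<lambda>\<beta>. \<Sum>cz\<in>UNIV. pmf \<nu> cz * (log 2 (F \<beta> cz) / \<beta>))
      \<longlongrightarrow> (\<Sum>cz\<in>UNIV. pmf \<nu> cz * G cz)) (at_right 0)"
    by (intro tendsto_intros)
  then have "((\<lambda>\<beta>. ereal (\<Sum>cz\<in>UNIV. pmf \<nu> cz * (log 2 (F \<beta> cz) / \<beta>)))
      \<longlongrightarrow> ereal ((chsh \<nu> - 2) / 2)) (at_right 0)"
    by (simp only: G_def sum_pmf_chsh_gain[OF \<nu>] lim_ereal)
  then show ?thesis
    by (rule tendsto_upperbound[OF _ ev]) simp
qed

section \<open>The guessing probability\<close>

lemma cond_prob_le_chsh:
  assumes \<sigma>: "\<sigma> \<in> ns_model P"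
  shows "cond_prob \<sigma> c z \<le> (6 - chsh \<sigma>) / 4"
proof (cases "chsh \<sigma> \<ge> 2")
  case True
  have "cond_prob \<sigma> c z \<le> (\<Sum>i\<in>UNIV. weight \<sigma> i * vertex_peak i)"
    unfolding cond_prob_vertex_sum[OF \<sigma>]
    using pmf_ns_vertex[of _ z c] vertex_peak_pos weight_nonneg[OF True]
    by (intro sum_mono mult_left_mono) (metis less_imp_le order_refl)+
  then show ?thesis
    by (simp add: sum_weight_vertex_peak[OF \<sigma>])
next
  case False
  \<comment> \<open>Here the bound exceeds 1. The case matters because members of a decomposition
    may have CHSH value below 2.\<close>
  then show ?thesis
    using cond_prob_le_1[of \<sigma> z c] by (simp add: input_dist_ns_model[OF \<sigma>] input_pos)
qed

lemma guess_value_le: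
  assumes \<nu>: "\<nu> \<in> ns_model P" and dec: "decomposition (ns_model P) \<nu> \<omega> \<sigma>"
  shows "guess_value P \<omega> \<sigma> \<le> (6 - chsh \<nu>) / 4"
proof -
  have \<sigma>: "\<sigma> e \<in> ns_model P" and \<omega>: "\<omega> e \<ge> 0" and "\<omega> sums 1"
    and sums: "(\<lambda>e. \<omega> e * pmf (\<sigma> e) cz) sums pmf \<nu> cz" for e cz
    using dec unfolding decomposition_def by blast+
  define g where "g e = (\<Sum>z\<in>UNIV. pmf P z * (MAX c. cond_prob (\<sigma> e) c z))" for e
  have "g e \<le> (\<Sum>z\<in>UNIV. pmf P z * ((6 - chsh (\<sigma> e)) / 4))" for e
    unfolding g_def using cond_prob_le_chsh[OF \<sigma>] by (intro sum_mono mult_left_mono Max.boundedI) auto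
  then have g_le: "g e \<le> (6 - chsh (\<sigma> e)) / 4" for e
    unfolding sum_distrib_right[symmetric] by (simp add: sum_pmf_eq_1)
  have "0 \<le> (MAX c. cond_prob (\<sigma> e) c z)" for e z
    by (subst Max_ge_iff) (auto intro: cond_prob_nonneg)
  then have g_ge: "g e \<ge> 0" for e
    unfolding g_def by (intro sum_nonneg) auto
  \<comment> \<open>The CHSH value is a finite linear combination of probabilities, so it passes
    through the countable mixture.\<close>
  have "(\<lambda>e. \<Sum>cz\<in>UNIV. \<omega> e * pmf (\<sigma> e) cz * I_CHSH P cz) sums (\<Sum>cz\<in>UNIV. pmf \<nu> cz * I_CHSH P cz)"
    by (intro sums_sum sums_mult2 sums)
  then have "(\<lambda>e. \<omega> e * chsh (\<sigma> e)) sums chsh \<nu>"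
    by (simp add: mult.assoc sum_pmf_I_CHSH \<sigma> \<nu> flip: sum_distrib_left)
  then have "(\<lambda>e. (6 * \<omega> e - \<omega> e * chsh (\<sigma> e)) / 4) sums ((6 * 1 - chsh \<nu>) / 4)"
    by (intro sums_divide sums_diff sums_mult \<open>\<omega> sums 1\<close>)
  then have S: "(\<lambda>e. \<omega> e * ((6 - chsh (\<sigma> e)) / 4)) sums ((6 - chsh \<nu>) / 4)"
    by (simp add: algebra_simps)
  have le: "\<omega> e * g e \<le> \<omega> e * ((6 - chsh (\<sigma> e)) / 4)" for e
    using g_le \<omega> by (rule mult_left_mono)
  have "summable (\<lambda>e. \<omega> e * g e)"
    using le g_ge \<omega> by (intro summable_comparison_test'[OF sums_summable[OF S], of 0]) auto
  then have "(\<Sum>e. \<omega> e * g e) \<le> (6 - chsh \<nu>) / 4"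
    unfolding sums_unique[OF S] using le sums_summable[OF S] by (intro suminf_le)
  then show ?thesis
    by (simp add: guess_value_def g_def)
qed

lemma guess_value_attained:
  assumes \<nu>: "\<nu> \<in> ns_model P" and ge: "chsh \<nu> \<ge> 2"
  obtains \<omega> \<sigma> where "decomposition (ns_model P) \<nu> \<omega> \<sigma>" "guess_value P \<omega> \<sigma> = (6 - chsh \<nu>) / 4"
proof -
  obtain n and h :: "nat \<Rightarrow> (bool \<times> bool \<times> bool) option" where h: "bij_betw h {..<n} UNIV"
    using ex_bij_betw_nat_finite[of "UNIV :: (bool \<times> bool \<times> bool) option set"]
    by (auto simp: atLeast0LessThan)
  define \<omega> where "\<omega> e = (if e < n then weight \<nu> (h e) else 0)" for e
  \<comment> \<open>For \<open>e \<ge> n\<close> the value \<open>h e\<close> is arbitrary, but it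
    still names a box in the model and carries weight 0.\<close>
  define \<sigma> where "\<sigma> e = ns_box P (h e)" for e
  have \<omega>: "(\<lambda>e. \<omega> e * f (h e)) sums (\<Sum>i\<in>UNIV. weight \<nu> i * f i)" for f
    using sums_bij_betw_finite[OF h, of "\<lambda>i. weight \<nu> i * f i"]
    by (simp add: \<omega>_def if_distrib[of "\<lambda>x. x * _"] cong: if_cong)
  have "decomposition (ns_model P) \<nu> \<omega> \<sigma>"
    unfolding decomposition_def
  proof (intro conjI allI)
    show "\<sigma> e \<in> ns_model P" for e
      by (simp add: \<sigma>_def ns_box_in_ns_model)
    show "0 \<le> \<omega> e" for e
      by (simp add: \<omega>_def weight_nonneg[OF ge])
    show "\<omega> sums 1"
      using \<omega>[of "\<lambda>_. 1"] by (simp add: sum_weight[OF \<nu>])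
    show "(\<lambda>e. \<omega> e * pmf (\<sigma> e) cz) sums pmf \<nu> cz" for cz
      using \<omega>[of "\<lambda>i. pmf (ns_box P i) cz"] by (simp add: \<sigma>_def pmf_box_sum[OF \<nu>])
  qed
  moreover have "(\<Sum>z\<in>UNIV. pmf P z * (MAX c. cond_prob (\<sigma> e) c z)) = vertex_peak (h e)" for e
    by (simp add: \<sigma>_def cond_prob_ns_box Max_pmf_ns_vertex sum_pmf_eq_1 flip: sum_distrib_right)
  then have "guess_value P \<omega> \<sigma> = (6 - chsh \<nu>) / 4"
    unfolding guess_value_def
    using sums_unique[OF \<omega>[of vertex_peak]] by (simp add: sum_weight_vertex_peak[OF \<nu>])
  ultimately show thesis
    by (rule that)
qed

lemma P_guess_eq:
  assumes "\<nu> \<in> ns_model P" and "chsh \<nu> \<ge> 2"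
  shows "P_guess (ns_model P) P \<nu> = (6 - chsh \<nu>) / 4"
  unfolding P_guess_def
proof (rule Greatest_equality)
  show "\<exists>\<omega> \<sigma>. decomposition (ns_model P) \<nu> \<omega> \<sigma> \<and> (6 - chsh \<nu>) / 4 = guess_value P \<omega> \<sigma>"
    using guess_value_attained[OF assms] by metis
qed (use guess_value_le[OF assms(1)] in auto)

lemma max_PEF_rate_le:
  assumes "\<nu> \<in> ns_model P" and "chsh \<nu> \<ge> 2"
  shows "max_PEF_rate (ns_model P) \<nu> \<le> ereal ((chsh \<nu> - 2) / 2)"
  unfolding max_PEF_rate_def PEF_rate_def
  using PEF_log_rate_le[OF _ assms] by (intro SUP_least) auto

end

theorem theorem16:
  fixes P :: "bits2 pmf" and \<nu> :: "(bits2 \<times> bits2) pmf" and Ihat :: real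
  assumes P_pos: "\<And>x y. pmf P (x, y) > 0"
    and \<nu>_in: "\<nu> \<in> ns_model P"
    and Ihat: "Ihat = measure_pmf.expectation \<nu> (I_CHSH P)"
    and Ihat_gt: "Ihat > 2"
  shows "max_PEF_rate (ns_model P) \<nu> = ereal ((Ihat - 2) / 2) \<and>
         H_min (ns_model P) P \<nu> = - log 2 ((6 - Ihat) / 4)"
proof -
  have I: "Ihat = chsh \<nu>"
    using sum_pmf_I_CHSH[OF P_pos \<nu>_in]
    by (simp add: Ihat integral_measure_pmf[of UNIV] mult.commute)
  then have "chsh \<nu> \<ge> 2"
    using Ihat_gt by simp
  then show ?thesis
    unfolding I H_min_def P_guess_eq[OF P_pos \<nu>_in \<open>chsh \<nu> \<ge> 2\<close>]
    using max_PEF_rate_ge[OF P_pos \<nu>_in] max_PEF_rate_le[OF P_pos \<nu>_in] by (blast intro: antisym)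
qed

end
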